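(* Let $G$ be a $d$-regular graph. Then $f(G)\leq b(G)$.
   Context: Graphs are finite and simple. A proper coloring of a graph $G$ assigns colors to the vertices so that adjacent vertices receive different colors; a proper coloring with $m$ available colors is called an $m$-coloring. A color class is the set of all vertices having the same color. In a proper coloring, a vertex of color $i$ is called dominant if it has a neighbor in each color class distinct from $i$ (that is, a neighbor of every available color other than its own). A $b$-coloring is a proper coloring in which each color class contains at least one dominant vertex. The $b$-chromatic number $b(G)$ is the largest positive integer $k$ such that $G$ has a $b$-coloring with $k$ colors. For a $d$-regular graph $G$, the $f$-chromatic vertex number $f(G)$ is the maximum number of dominant vertices of pairwise distinct colors in a proper coloring of $G$ with $d+1$ colors. *)

theory Defs
  imports "Graph_Theory.Digraph"
begin

text \<open>
  A finite simple graph is a loop-free symmetric digraph without multiple arcs on a finite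
  vertex set (locale \<^locale>\<open>graph\<close>). Each undirected edge corresponds to two opposite arcs,
  so the degree of a vertex is its out-degree.
\<close>

definition regular_graph :: "('a, 'b) pre_digraph \<Rightarrow> nat \<Rightarrow> bool" where
  "regular_graph G d \<longleftrightarrow> graph G \<and> (\<forall>v \<in> verts G. out_degree G v = d)"

text \<open>
  The \<open>m\<close> available colors are the numbers below \<open>m\<close>; a coloring need not use all of them.
  The values of \<open>c\<close> outside \<open>verts G\<close> are irrelevant.
\<close>

definition proper_coloring :: "('a, 'b) pre_digraph \<Rightarrow> nat \<Rightarrow> ('a \<Rightarrow> nat) \<Rightarrow> bool" where
  "proper_coloring G m c \<longleftrightarrow>
     (\<forall>v \<in> verts G. c v < m) \<and> (\<forall>u v. u \<rightarrow>\<^bsub>G\<^esub> v \<longrightarrow> c u \<noteq> c v)"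

definition color_class :: "('a, 'b) pre_digraph \<Rightarrow> ('a \<Rightarrow> nat) \<Rightarrow> nat \<Rightarrow> 'a set" where
  "color_class G c i = {v \<in> verts G. c v = i}"

text \<open>
  Unused available colors count, so a coloring that misses an available color has no
  dominant vertex.
\<close>

definition dominant_vertex ::
  "('a, 'b) pre_digraph \<Rightarrow> nat \<Rightarrow> ('a \<Rightarrow> nat) \<Rightarrow> 'a \<Rightarrow> bool" where
  "dominant_vertex G m c v \<longleftrightarrow>
     v \<in> verts G \<and> (\<forall>j < m. j \<noteq> c v \<longrightarrow> (\<exists>w \<in> color_class G c j. v \<rightarrow>\<^bsub>G\<^esub> w))"

definition b_coloring :: "('a, 'b) pre_digraph \<Rightarrow> nat \<Rightarrow> ('a \<Rightarrow> nat) \<Rightarrow> bool" where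
  "b_coloring G k c \<longleftrightarrow>
     proper_coloring G k c \<and> (\<forall>i < k. \<exists>v \<in> color_class G c i. dominant_vertex G k c v)"

text \<open>
  For a finite graph with at least one vertex the set below is finite and nonempty; for the
  graph without vertices it is empty and the value is unspecified.
\<close>

definition b_chromatic_number :: "('a, 'b) pre_digraph \<Rightarrow> nat" where
  "b_chromatic_number G = Max {k. 0 < k \<and> (\<exists>c. b_coloring G k c)}"

text \<open>
  The degree is a parameter; it is determined by \<open>G\<close> when \<open>G\<close> is \<open>d\<close>-regular with at least one
  vertex. The set is nonempty because a \<open>d\<close>-regular graph has a proper coloring with \<open>d + 1\<close>
  colors.
\<close>

definition f_chromatic_vertex_number :: "('a, 'b) pre_digraph \<Rightarrow> nat \<Rightarrow> nat" where
  "f_chromatic_vertex_number G d =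
     Max {card S | S c. proper_coloring G (d + 1) c \<and>
                        (\<forall>v \<in> S. dominant_vertex G (d + 1) c v) \<and> inj_on c S}"

end

theory Submission
  imports Defs "HOL-Combinatorics.Transposition"
begin

text \<open>
  The argument is the elimination of colors without dominant vertices. If no vertex of color
  \<open>i\<close> is dominant, then each vertex of color \<open>i\<close> misses some other color in its neighborhood
  and can be moved to that color. The class is independent, so all these moves can be made at
  once, and color \<open>i\<close> disappears. A vertex that was dominant before has a color other than
  \<open>i\<close>; its neighbors of the remaining colors have not been touched, so it keeps its color and
  stays dominant for the smaller set of colors (\<open>remove_color\<close>). Iteration ends with a
  b-coloring in which all initially dominant vertices are still dominant, with the same color
  classes among them; so it has at least as many colors as there are dominant vertices of
  pairwise distinct colors at the start (\<open>reduce_to_b_coloring\<close>).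

  For the theorem, take a proper coloring with \<open>d + 1\<close> colors attaining \<open>f(G)\<close> and reduce it.
  That such a coloring exists follows from the same reduction, applied to the coloring that
  gives every vertex its own color: in a b-coloring with \<open>k\<close> colors a dominant vertex has
  neighbors of \<open>k - 1\<close> different colors, so that \<open>k \<le> d + 1\<close>.
\<close>

lemma dominant_vertex_colors_le_degree:
  assumes "graph G" "dominant_vertex G m c v"
  shows "m \<le> out_degree G v + 1"
proof -
  interpret graph G by fact
  have fin: "finite (out_arcs G v)" by (rule finite_out_arcs)
  have "{..<m} - {c v} \<subseteq> (\<lambda>e. c (head G e)) ` out_arcs G v"
  proof
    fix j assume "j \<in> {..<m} - {c v}"
    then obtain w where w: "c w = j" "v \<rightarrow>\<^bsub>G\<^esub> w"
      using assms(2) unfolding dominant_vertex_def color_class_def by auto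
    then show "j \<in> (\<lambda>e. c (head G e)) ` out_arcs G v"
      by (auto simp: arcs_ends_def arc_to_ends_def out_arcs_def)
  qed
  then have "card ({..<m} - {c v}) \<le> out_degree G v"
    unfolding out_degree_def using surj_card_le[OF fin] by blast
  moreover have "m - 1 \<le> card ({..<m} - {c v})"
    using diff_card_le_card_Diff[of "{c v}" "{..<m}"] by simp
  ultimately show ?thesis by linarith
qed

text \<open>
  Every color of a b-coloring has a dominant vertex, and these are distinct. The bound makes
  the set of color numbers of b-colorings finite, so that its maximum is meaningful.
\<close>
lemma b_coloring_le_card_verts:
  assumes "graph G" "b_coloring G k c"
  shows "k \<le> card (verts G)"
proof -
  interpret graph G by fact
  have "{..<k} \<subseteq> c ` verts G"
    using assms(2) unfolding b_coloring_def color_class_def by fastforce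
  then show ?thesis using surj_card_le[of "verts G" "{..<k}" c] by simp
qed

lemma b_coloring_le_b_chromatic_number:
  assumes "graph G" "0 < k" "b_coloring G k c"
  shows "k \<le> b_chromatic_number G"
proof -
  have "{k. 0 < k \<and> (\<exists>c. b_coloring G k c)} \<subseteq> {..card (verts G)}"
    using b_coloring_le_card_verts[OF assms(1)] by auto
  then have "finite {k. 0 < k \<and> (\<exists>c. b_coloring G k c)}"
    using finite_subset by blast
  then show ?thesis
    unfolding b_chromatic_number_def using assms by (intro Max_ge) auto
qed

text \<open>
  The elimination step. The transposition of \<open>i\<close> and \<open>m\<close> only renames the remaining colors so
  that they are again the numbers below \<open>m\<close>.
\<close>
lemma remove_color:
  assumes "graph G" and proper: "proper_coloring G (Suc m) c" and "i < Suc m"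
    and nodom: "\<And>v. v \<in> color_class G c i \<Longrightarrow> \<not> dominant_vertex G (Suc m) c v"
  obtains c' where "proper_coloring G m c'"
    and "\<And>v. dominant_vertex G (Suc m) c v \<Longrightarrow> dominant_vertex G m c' v"
    and "\<And>v. dominant_vertex G (Suc m) c v \<Longrightarrow> c' v = Transposition.transpose i m (c v)"
proof -
  interpret graph G by fact
  have "\<exists>j. j < Suc m \<and> j \<noteq> i \<and> (\<forall>w. v \<rightarrow>\<^bsub>G\<^esub> w \<longrightarrow> c w \<noteq> j)"
    if "v \<in> verts G" "c v = i" for v
    using nodom[of v] that unfolding dominant_vertex_def color_class_def
    by (auto dest: adj_in_verts)
  then obtain q where q: "\<And>v. v \<in> verts G \<Longrightarrow> c v = i \<Longrightarrow>
      q v < Suc m \<and> q v \<noteq> i \<and> (\<forall>w. v \<rightarrow>\<^bsub>G\<^esub> w \<longrightarrow> c w \<noteq> q v)"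
    by metis
  define r where "r v = (if c v = i then q v else c v)" for v
  define c' where "c' v = Transposition.transpose i m (r v)" for v
  have c_less: "c v < Suc m" if "v \<in> verts G" for v
    using proper that unfolding proper_coloring_def by blast
  have c_adj: "c u \<noteq> c v" if "u \<rightarrow>\<^bsub>G\<^esub> v" for u v
    using proper that unfolding proper_coloring_def by blast
  have r_less: "r v < Suc m \<and> r v \<noteq> i" if "v \<in> verts G" for v
    using q[OF that] c_less[OF that] unfolding r_def by auto
  have r_adj: "r u \<noteq> r v" if "u \<rightarrow>\<^bsub>G\<^esub> v" for u v
  proof -
    have "v \<rightarrow>\<^bsub>G\<^esub> u" "u \<in> verts G" "v \<in> verts G"
      using that arcs_ends_symmetric[OF sym_arcs] adj_in_verts by blast+
    then show ?thesis
      using q[of u] q[of v] c_adj[OF that] that unfolding r_def by metis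
  qed
  have tr_less: "Transposition.transpose i m j < m" if "j < Suc m" "j \<noteq> i" for j
    using that \<open>i < Suc m\<close> unfolding transpose_def by auto
  have "proper_coloring G m c'"
    unfolding proper_coloring_def c'_def using r_less tr_less r_adj
    by (auto dest: transpose_eq_imp_eq)
  moreover have c'_dom: "c' v = Transposition.transpose i m (c v)"
    if "dominant_vertex G (Suc m) c v" for v
    using that nodom[of v] unfolding c'_def r_def
    by (auto simp: dominant_vertex_def color_class_def)
  moreover have "dominant_vertex G m c' v" if dom: "dominant_vertex G (Suc m) c v" for v
  proof -
    have v: "v \<in> verts G" using dom unfolding dominant_vertex_def by blast
    have "\<exists>w \<in> color_class G c' j. v \<rightarrow>\<^bsub>G\<^esub> w" if "j < m" "j \<noteq> c' v" for j
    proof -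
      \<comment> \<open>the old name of the color \<open>j\<close>; its vertices have not been recolored\<close>
      define l where "l = Transposition.transpose i m j"
      have l: "l < Suc m" "l \<noteq> i" "Transposition.transpose i m l = j"
        using that \<open>i < Suc m\<close> unfolding l_def by (auto simp: transpose_def)
      then have "l \<noteq> c v" using that(2) c'_dom[OF dom] by auto
      then obtain w where "w \<in> verts G" "c w = l" "v \<rightarrow>\<^bsub>G\<^esub> w"
        using dom l(1) unfolding dominant_vertex_def color_class_def by auto
      then show ?thesis
        using l unfolding color_class_def c'_def r_def by auto
    qed
    then show ?thesis unfolding dominant_vertex_def using v by blast
  qed
  ultimately show thesis using that by blast
qed

lemma reduce_to_b_coloring:
  assumes "graph G" "proper_coloring G m c"
    and "\<forall>v \<in> S. dominant_vertex G m c v" "inj_on c S"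
  shows "\<exists>k c'. b_coloring G k c' \<and> card S \<le> k"
  using assms(2-)
proof (induction m arbitrary: c)
  case 0
  then have "verts G = {}" unfolding proper_coloring_def by auto
  then have "S = {}" using 0 unfolding dominant_vertex_def by auto
  then show ?case using 0 unfolding b_coloring_def by auto
next
  case (Suc m)
  show ?case
  proof (cases "b_coloring G (Suc m) c")
    case True
    have "c ` S \<subseteq> {..<Suc m}"
      using Suc.prems unfolding proper_coloring_def dominant_vertex_def by blast
    then have "card S \<le> Suc m"
      using Suc.prems(3) card_inj_on_le[of c S "{..<Suc m}"] by simp
    then show ?thesis using True by blast
  next
    case False
    then obtain i where i: "i < Suc m"
        "\<And>v. v \<in> color_class G c i \<Longrightarrow> \<not> dominant_vertex G (Suc m) c v"
      using Suc.prems(1) unfolding b_coloring_def by blast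
    obtain c' where c': "proper_coloring G m c'"
        "\<And>v. dominant_vertex G (Suc m) c v \<Longrightarrow> dominant_vertex G m c' v"
        "\<And>v. dominant_vertex G (Suc m) c v \<Longrightarrow> c' v = Transposition.transpose i m (c v)"
      using remove_color[OF assms(1) Suc.prems(1) i] by blast
    have "inj_on c' S"
      using Suc.prems(2,3) c'(3) by (auto simp: inj_on_def dest: transpose_eq_imp_eq)
    then show ?thesis using Suc.IH[OF c'(1)] Suc.prems(2) c'(2) by blast
  qed
qed

text \<open>
  Without such a coloring \<open>f_chromatic_vertex_number\<close> would be the maximum of an empty set.
  Reduction of a coloring with pairwise distinct colors takes the place of greedy coloring:
  no vertex has enough neighbors to be dominant among more than \<open>d + 1\<close> colors.
\<close>
lemma regular_graph_proper_coloring: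
  assumes "regular_graph G d"
  shows "\<exists>c. proper_coloring G (d + 1) c"
proof -
  interpret graph G using assms unfolding regular_graph_def by blast
  obtain c0 where c0: "c0 ` verts G = {..<card (verts G)}" "inj_on c0 (verts G)"
    using ex_bij_betw_finite_nat[of "verts G"]
    unfolding bij_betw_def lessThan_atLeast0 by auto
  have "proper_coloring G (card (verts G)) c0"
    unfolding proper_coloring_def
    using c0 adj_not_same adj_in_verts unfolding inj_on_def by blast
  then obtain k c where b: "b_coloring G k c"
    using reduce_to_b_coloring[OF graph_axioms, of _ c0 "{}"] by fastforce
  have "k \<le> d + 1"
  proof (cases "k = 0")
    case False
    then obtain v where "dominant_vertex G k c v"
      using b unfolding b_coloring_def by blast
    moreover from this have "out_degree G v = d"
      using assms unfolding regular_graph_def dominant_vertex_def by blast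
    ultimately show ?thesis
      using dominant_vertex_colors_le_degree[OF graph_axioms] by metis
  qed simp
  then have "proper_coloring G (d + 1) c"
    using b unfolding b_coloring_def proper_coloring_def
    by (auto intro: less_le_trans)
  then show ?thesis by blast
qed

theorem theorem1p1:
  fixes G :: "('a, 'b) pre_digraph" and d :: nat
  assumes "regular_graph G d"
  shows "f_chromatic_vertex_number G d \<le> b_chromatic_number G"
proof -
  interpret graph G using assms unfolding regular_graph_def by blast
  let ?F = "{card S | S c. proper_coloring G (d + 1) c \<and>
              (\<forall>v \<in> S. dominant_vertex G (d + 1) c v) \<and> inj_on c S}"
  have "?F \<subseteq> {..card (verts G)}"
    by (auto simp: dominant_vertex_def intro!: card_mono)
  then have "finite ?F" using finite_subset by blast
  moreover have "?F \<noteq> {}"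
    using regular_graph_proper_coloring[OF assms] by (auto intro: exI[of _ "{}"])
  moreover have "x \<le> b_chromatic_number G" if "x \<in> ?F" for x
  proof (cases "x = 0")
    case False
    from that obtain k c where "b_coloring G k c" "x \<le> k"
      using reduce_to_b_coloring[OF graph_axioms] by blast
    then show ?thesis
      using b_coloring_le_b_chromatic_number[OF graph_axioms, of k c] False by simp
  qed simp
  ultimately show ?thesis
    unfolding f_chromatic_vertex_number_def by (subst Max_le_iff) auto
qed

end
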